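(* Let $N,t,k,v$ be positive integers with $k\ge t\ge 2$ and $v\ge 2$, and let $p=1/v^t$. Let \[ b=\binom{k}{t}v^t(1-p)^{N+1}\sqrt{\frac{1}{1-2p}}, \] and suppose $1/e^N<b<1$. Then there exists a $\mathsf{CA}_\lambda(N;t,k,v)$, where \[ \lambda=\left\lceil N\exp\left(1+W_{-1}\!\left(\frac{\log b}{eN}\right)\right)\right\rceil-1. \]
   Context: A covering array $\mathsf{CA}_\lambda(N;t,k,v)$ is an $N\times k$ array with entries from an alphabet $\Sigma$ of size $v$ such that for every set of $t$ distinct columns and every tuple $x\in\Sigma^t$, the tuple $x$ occurs as a row of the $N\times t$ subarray formed by those columns at least $\lambda$ times. $\log$ is the natural logarithm. $W_{-1}$ is the lower real branch of the Lambert $W$ function: for $-1/e\le x<0$, $W_{-1}(x)$ is the unique real $w\le -1$ with $we^w=x$. *)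

theory Defs
  imports Complex_Main "Jordan_Normal_Form.DL_Submatrix"
begin

text \<open>
  Rows and columns are numbered from 0. The matrix \<open>submatrix A {..<N} C\<close> keeps all rows of
  \<open>A\<close> and the columns in \<open>C\<close>, in increasing order, so its rows are \<open>t\<close>-tuples. The alphabet
  \<open>\<Sigma>\<close> is a parameter; its size is the parameter \<open>v\<close> of the usual notation.
\<close>

definition covering_array ::
  "nat \<Rightarrow> nat \<Rightarrow> nat \<Rightarrow> nat \<Rightarrow> nat \<Rightarrow> 'a set \<Rightarrow> 'a mat \<Rightarrow> bool" where
  "covering_array l N t k v \<Sigma> A \<longleftrightarrow>
     finite \<Sigma> \<and> card \<Sigma> = v \<and>
     A \<in> carrier_mat N k \<and> elements_mat A \<subseteq> \<Sigma> \<and>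
     (\<forall>C x. C \<subseteq> {..<k} \<and> card C = t \<and> x \<in> carrier_vec t \<and> set\<^sub>v x \<subseteq> \<Sigma> \<longrightarrow>
        card {i. i < N \<and> row (submatrix A {..<N} C) i = x} \<ge> l)"

text \<open>The lower real branch of the Lambert function, meaningful for \<open>- 1 / exp 1 \<le> x < 0\<close>.\<close>

definition Lambert_W_m1 :: "real \<Rightarrow> real" where
  "Lambert_W_m1 x = (THE w. w \<le> -1 \<and> w * exp w = x)"

end

theory Submission
  imports Defs
begin

text \<open>
  Choose the rows independently and uniformly from \<open>\<Sigma>\<close>-valued \<open>k\<close>-tuples. A fixed \<open>t\<close>-tuple in
  fixed columns occurs fewer than \<open>l\<close> times with probability
  \<open>(\<Sum>j<l. (N choose j) * p ^ j * (1 - p) ^ (N - j))\<close>, which is at most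
  \<open>(1 - p) ^ N * (\<Sum>j<l. N choose j) \<le> (1 - p) ^ N * (e * N / l) ^ l\<close> because \<open>p \<le> 1 - p\<close>.
  Since \<open>(1 - p) / sqrt (1 - 2 * p) \<ge> 1\<close>, the union bound shows that some array works as soon as
  \<open>b * (e * N / l) ^ l < 1\<close>. The number \<open>x = N * exp (1 + W)\<close> solves \<open>b * (e * N / x) ^ x = 1\<close>,
  the left-hand side increases for \<open>x \<le> N\<close>, and \<open>l = \<lceil>x\<rceil> - 1 < x\<close>.
\<close>

section \<open>The Lambert function\<close>

text \<open>Multiply \<open>1 + d < exp d\<close>, for \<open>d = w' - w\<close>, by the negative
  number \<open>w'\<close>: the result exceeds \<open>w\<close> by \<open>d * (w' + 1)\<close>,
  which is nonpositive on this branch.\<close>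

lemma mult_exp_strict_antimono:
  fixes w w' :: real
  assumes "w < w'" "w' \<le> -1"
  shows "w' * exp w' < w * exp w"
proof -
  have "1 + (w' - w) < exp (w' - w)"
    using assms exp_minus_greater[of "w - w'"] by simp
  then have "w' * exp (w' - w) < w' * (1 + (w' - w))"
    using assms by (simp add: mult_less_cancel_left)
  also have "\<dots> = w + (w' - w) * (w' + 1)" by (simp add: algebra_simps)
  also have "\<dots> \<le> w" using assms by (simp add: mult_nonneg_nonpos)
  finally have "exp w * (w' * exp (w' - w)) < exp w * w" by simp
  then show ?thesis by (simp add: exp_diff algebra_simps)
qed

text \<open>This justifies the definite description: existence comes from the intermediate value
  theorem on \<open>[a, -1]\<close>, uniqueness from strict monotonicity.\<close>

lemma Lambert_W_m1:
  assumes "- 1 / exp 1 \<le> x" "x < 0"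
  shows "Lambert_W_m1 x \<le> -1" "Lambert_W_m1 x * exp (Lambert_W_m1 x) = x"
proof -
  \<comment> \<open>The left endpoint must satisfy \<open>x \<le> a * exp a\<close>. The quadratic
    Taylor bound gives \<open>a * (a * exp a) < 2\<close>, and \<open>a \<le> 2 / x\<close> gives
    \<open>2 \<le> a * x\<close>; cancelling the negative \<open>a\<close> reverses the
    inequality.\<close>
  define a where "a = min (-1) (2 / x)"
  have a: "a \<le> -1" "a < 0" by (auto simp: a_def)
  have "(-a)\<^sup>2 / 2 < exp (-a)"
    using exp_lower_Taylor_quadratic[of "-a"] a by simp
  then have "a\<^sup>2 * exp a < 2"
    by (simp add: exp_minus field_simps)
  have "a * x \<ge> 2"
  proof -
    have "a \<le> 2 / x" by (simp add: a_def)
    then show ?thesis using assms(2) by (simp add: neg_le_divide_eq)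
  qed
  with \<open>a\<^sup>2 * exp a < 2\<close> have "a * (a * exp a) < a * x"
    by (simp add: power2_eq_square algebra_simps)
  then have "x \<le> a * exp a"
    using a by (simp add: mult_less_cancel_left)
  moreover have "-1 * exp (-1) \<le> x"
    using assms by (simp add: exp_minus field_simps)
  moreover have "\<forall>w. a \<le> w \<and> w \<le> -1 \<longrightarrow> isCont (\<lambda>w. w * exp w) w" by auto
  ultimately obtain w where w: "w \<le> -1" "w * exp w = x"
    using IVT2[of "\<lambda>w. w * exp w" "-1" x a] a by auto
  have "\<exists>!w. w \<le> -1 \<and> w * exp w = x"
  proof (rule ex1I[of _ w])
    fix y assume "y \<le> -1 \<and> y * exp y = x"
    then show "y = w"
      using w mult_exp_strict_antimono[of y w] mult_exp_strict_antimono[of w y] by fastforce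
  qed (use w in auto)
  from theI'[OF this]
  show "Lambert_W_m1 x \<le> -1" "Lambert_W_m1 x * exp (Lambert_W_m1 x) = x"
    unfolding Lambert_W_m1_def by auto
qed

text \<open>For \<open>u = ln (l / N) - 1\<close> the hypothesis on \<open>l\<close> reads
  \<open>u < w\<close>. Since \<open>exp u = l / (e * N)\<close>, the second conclusion is
  \<open>ln b < l * u\<close>, which after division by \<open>e * N\<close> is
  \<open>w * exp w < u * exp u\<close>.\<close>

lemma less_exp_Lambert_W_m1_imp:
  fixes b :: real and N l :: nat
  assumes "N > 0" "l > 0" "1 / exp 1 ^ N < b" "b < 1"
    and l: "real l < real N * exp (1 + Lambert_W_m1 (ln b / (exp 1 * real N)))"
  shows "l < N" "b * (exp 1 * real N / real l) ^ l < 1"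
proof -
  define w where "w = Lambert_W_m1 (ln b / (exp 1 * real N))"
  have b: "b > 0" using assms(3) by (smt (verit) divide_pos_pos exp_gt_zero zero_less_power)
  \<comment> \<open>The two bounds on \<open>b\<close> place \<open>ln b / (e * N)\<close> in the
    domain of the branch, between \<open>-1 / e\<close> and 0.\<close>
  have "exp (- real N) < b"
    using assms(3) by (simp add: exp_minus exp_of_nat_mult[symmetric] inverse_eq_divide)
  then have "- real N < ln b" using b by (metis exp_less_cancel_iff exp_ln)
  moreover have "ln b < 0" using b assms(4) by simp
  ultimately have w: "w \<le> -1" "w * exp w = ln b / (exp 1 * real N)"
    using Lambert_W_m1[of "ln b / (exp 1 * real N)"] assms(1)
    unfolding w_def by (auto simp: field_simps)
  have "real l < real N * exp (1 + w)" using l by (simp add: w_def)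
  also have "\<dots> \<le> real N * 1" using w by (intro mult_left_mono) auto
  finally show "l < N" by simp
  define u where "u = ln (real l / real N) - 1"
  have exp_u: "exp u = real l / (exp 1 * real N)"
    using assms by (simp add: u_def exp_diff field_simps)
  have "exp u < exp w"
    using l[folded w_def] assms(1,2) by (simp add: exp_u exp_add field_simps)
  then have "u < w" by simp
  then have "w * exp w < u * exp u"
    using w(1) by (rule mult_exp_strict_antimono)
  then have "ln b < real l * u"
    using assms unfolding w exp_u by (simp add: field_simps)
  then have "b < exp (real l * u)"
    using b by (metis exp_less_cancel_iff exp_ln)
  also have "\<dots> = exp u ^ l" by (rule exp_of_nat_mult)
  finally have "b * (exp 1 * real N / real l) ^ l < exp u ^ l * (exp 1 * real N / real l) ^ l"
    using assms by (intro mult_strict_right_mono) auto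
  also have "\<dots> = 1"
    using assms by (simp add: exp_u power_mult_distrib[symmetric])
  finally show "b * (exp 1 * real N / real l) ^ l < 1" .
qed

section \<open>Counting\<close>

text \<open>A Chernoff-type argument: with \<open>c = l / N \<le> 1\<close>, each
  \<open>j < l\<close> has \<open>c ^ l \<le> c ^ j\<close>, and the full binomial sum is
  \<open>(c + 1) ^ N \<le> exp (c * N) = exp l\<close>.\<close>

lemma sum_choose_le:
  assumes "l > 0" "l \<le> N"
  shows "(\<Sum>j<l. real (N choose j)) \<le> (exp 1 * real N / real l) ^ l"
proof -
  define c where "c = real l / real N"
  have c: "0 < c" "c \<le> 1" using assms by (auto simp: c_def)
  have "(\<Sum>j<l. real (N choose j)) * c ^ l = (\<Sum>j<l. real (N choose j) * c ^ l)"
    by (rule sum_distrib_right)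
  also have "\<dots> \<le> (\<Sum>j<l. real (N choose j) * c ^ j)"
    using c by (intro sum_mono mult_left_mono power_decreasing) auto
  also have "\<dots> \<le> (\<Sum>j\<le>N. real (N choose j) * c ^ j)"
    using c assms by (intro sum_mono2) auto
  also have "\<dots> = (c + 1) ^ N" by (simp add: binomial_ring)
  also have "\<dots> \<le> exp c ^ N"
    using c by (intro power_mono) (auto simp: add.commute)
  also have "\<dots> = exp 1 ^ l"
    using assms by (simp add: c_def flip: exp_of_nat_mult)
  finally show ?thesis
    using c assms by (simp add: c_def power_divide power_mult_distrib field_simps)
qed

lemma card_subsets_card_less:
  assumes "finite X"
  shows "card {I. I \<subseteq> X \<and> card I < l} = (\<Sum>j<l. card X choose j)"
proof -
  have "{I. I \<subseteq> X \<and> card I < l} = (\<Union>j<l. {I. I \<subseteq> X \<and> card I = j})" by auto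
  also have "card \<dots> = (\<Sum>j<l. card {I. I \<subseteq> X \<and> card I = j})"
    using assms by (intro card_UN_disjoint) auto
  finally show ?thesis using n_subsets[OF assms] by simp
qed

text \<open>Functions are grouped by the set \<open>I\<close> of arguments sent into
  \<open>S\<close>. As \<open>S\<close> is no larger than its complement, each group has at most
  \<open>(card R - card S) ^ N\<close> members, whatever \<open>I\<close> is.\<close>

lemma card_funcset_few_hits_le:
  assumes "finite R" "S \<subseteq> R" "2 * card S \<le> card R"
  shows "card {f \<in> {..<N} \<rightarrow>\<^sub>E R. card {i. i < N \<and> f i \<in> S} < l}
    \<le> (card R - card S) ^ N * (\<Sum>j<l. N choose j)" (is "card ?B \<le> _")
proof -
  define J where "J = {I. I \<subseteq> {..<N} \<and> card I < l}"
  define F where "F I = (\<Pi>\<^sub>E i\<in>{..<N}. if i \<in> I then S else R - S)" for I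
  have finS: "finite S" using assms finite_subset by blast
  have J: "finite J" unfolding J_def by (rule finite_subset[of _ "Pow {..<N}"]) auto
  have finF: "finite (F I)" for I
    unfolding F_def using assms finS by (intro finite_PiE) auto
  have F: "card (F I) \<le> (card R - card S) ^ N" for I
  proof -
    have "card (F I) = (\<Prod>i<N. card (if i \<in> I then S else R - S))"
      unfolding F_def by (simp add: card_PiE)
    also have "\<dots> \<le> (\<Prod>i<N. card R - card S)"
      using assms finS by (intro prod_mono) (auto simp: card_Diff_subset)
    finally show ?thesis by simp
  qed
  have "?B \<subseteq> (\<Union>I\<in>J. F I)"
  proof
    fix f assume f: "f \<in> ?B"
    then have "{i. i < N \<and> f i \<in> S} \<in> J" by (auto simp: J_def)
    moreover have "f \<in> F {i. i < N \<and> f i \<in> S}"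
      using f by (auto simp: F_def PiE_iff)
    ultimately show "f \<in> (\<Union>I\<in>J. F I)" by blast
  qed
  then have "card ?B \<le> card (\<Union>I\<in>J. F I)"
    using J finF by (intro card_mono) auto
  also have "\<dots> \<le> (\<Sum>I\<in>J. card (F I))" using J by (rule card_UN_le)
  also have "\<dots> \<le> (\<Sum>I\<in>J. (card R - card S) ^ N)" by (intro sum_mono F)
  also have "\<dots> = (card R - card S) ^ N * (\<Sum>j<l. N choose j)"
    using card_subsets_card_less[of "{..<N}" l] by (simp add: J_def)
  finally show ?thesis .
qed

text \<open>Union bound in counting form: if every function failed for some \<open>q\<close>, the
  failure sets \<open>B q\<close> would cover the whole function space, contradicting the bound on
  their total size.\<close>

lemma ex_funcset_many_hits:
  assumes "finite R" "finite P"
    and S: "\<And>q. q \<in> P \<Longrightarrow> S q \<subseteq> R" "\<And>q. q \<in> P \<Longrightarrow> card (S q) = s" "2 * s \<le> card R"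
    and less: "card P * ((card R - s) ^ N * (\<Sum>j<l. N choose j)) < card R ^ N"
  shows "\<exists>f \<in> {..<N} \<rightarrow>\<^sub>E R. \<forall>q\<in>P. l \<le> card {i. i < N \<and> f i \<in> S q}"
proof (rule ccontr)
  assume contra: "\<not> ?thesis"
  define B where "B q = {f \<in> {..<N} \<rightarrow>\<^sub>E R. card {i. i < N \<and> f i \<in> S q} < l}" for q
  have fin: "finite ({..<N} \<rightarrow>\<^sub>E R)" using assms by (intro finite_PiE) auto
  have "card R ^ N = card ({..<N} \<rightarrow>\<^sub>E R)" by (simp add: card_PiE)
  also have "\<dots> \<le> card (\<Union>q\<in>P. B q)"
    using contra fin assms(2) by (intro card_mono) (auto simp: B_def not_le)
  also have "\<dots> \<le> (\<Sum>q\<in>P. card (B q))" using assms(2) by (rule card_UN_le)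
  also have "\<dots> \<le> (\<Sum>q\<in>P. (card R - s) ^ N * (\<Sum>j<l. N choose j))"
  proof (rule sum_mono)
    fix q assume "q \<in> P"
    with S have "S q \<subseteq> R" "card (S q) = s" by auto
    with card_funcset_few_hits_le[of R "S q" N l] assms(1) S(3)
    show "card (B q) \<le> (card R - s) ^ N * (\<Sum>j<l. N choose j)"
      by (simp add: B_def)
  qed
  finally show False using less by simp
qed

section \<open>Covering arrays\<close>

lemma pick_lessThan:
  assumes "i < N"
  shows "pick {..<N} i = i"
proof -
  have "{a \<in> {..<N}. a < i} = {..<i}" using assms by auto
  with pick_card_in_set[of i "{..<N}"] assms show ?thesis by simp
qed

lemma row_submatrix_mat:
  assumes "i < N" "C \<subseteq> {..<k}"
  shows "row (submatrix (mat N k f) {..<N} C) i = vec (card C) (\<lambda>j. f (i, pick C j))"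
proof -
  have [simp]: "{j. j < k \<and> j \<in> C} = C" "{i. i < N} = {..<N}" using assms by auto
  have "pick C j < k" if "j < card C" for j
    using pick_in_set_le[OF that] assms by auto
  then show ?thesis
    using assms by (auto simp: submatrix_def pick_lessThan)
qed

lemma card_vecs_le:
  assumes "finite \<Sigma>"
  shows "finite {x \<in> carrier_vec t. set\<^sub>v x \<subseteq> \<Sigma>}"
    and "card {x \<in> carrier_vec t. set\<^sub>v x \<subseteq> \<Sigma>} \<le> card \<Sigma> ^ t"
proof -
  let ?V = "{x \<in> carrier_vec t. set\<^sub>v x \<subseteq> \<Sigma>}" and ?F = "{..<t} \<rightarrow>\<^sub>E \<Sigma>"
  have fin: "finite ?F" using assms by (intro finite_PiE) auto
  have sub: "?V \<subseteq> vec t ` ?F"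
  proof
    fix x assume x: "x \<in> ?V"
    then have "x = vec t (restrict (($) x) {..<t})" by (intro eq_vecI) auto
    moreover have "restrict (($) x) {..<t} \<in> ?F" using x by (auto intro!: vec_setI)
    ultimately show "x \<in> vec t ` ?F" by blast
  qed
  show "finite ?V" using sub fin finite_surj by blast
  have "card ?V \<le> card ?F" using sub fin by (rule surj_card_le[rotated])
  then show "card ?V \<le> card \<Sigma> ^ t" by (simp add: card_PiE)
qed

text \<open>The condition prescribes the row on \<open>C\<close> and leaves the other
  \<open>k - card C\<close> entries free.\<close>

lemma card_rows_matching:
  assumes "finite \<Sigma>" "C \<subseteq> {..<k}" "x \<in> carrier_vec (card C)" "set\<^sub>v x \<subseteq> \<Sigma>"
  shows "card {r \<in> {..<k} \<rightarrow>\<^sub>E \<Sigma>. vec (card C) (\<lambda>j. r (pick C j)) = x} = card \<Sigma> ^ (k - card C)"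
proof -
  have finC: "finite C" using assms finite_subset by blast
  \<comment> \<open>The number of elements of \<open>C\<close> below \<open>c\<close> is the
    position of \<open>c\<close> in \<open>C\<close>, so this index inverts
    \<open>pick C\<close>.\<close>
  define g where "g c = x $ card {a \<in> C. a < c}" for c
  have idx: "card {a \<in> C. a < c} < card C" if "c \<in> C" for c
    using that finC by (intro psubset_card_mono) auto
  have g: "g c \<in> \<Sigma>" if "c \<in> C" for c
    using idx[OF that] assms by (auto simp: g_def intro!: vec_setI)
  have match: "vec (card C) (\<lambda>j. r (pick C j)) = x \<longleftrightarrow> (\<forall>c\<in>C. r c = g c)" for r
  proof
    assume eq: "vec (card C) (\<lambda>j. r (pick C j)) = x"
    show "\<forall>c\<in>C. r c = g c"
      using idx by (auto simp: g_def pick_card_in_set simp flip: eq)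
  next
    assume "\<forall>c\<in>C. r c = g c"
    then show "vec (card C) (\<lambda>j. r (pick C j)) = x"
      using assms by (intro eq_vecI) (auto simp: g_def pick_in_set_le card_pick_le)
  qed
  have "{r \<in> {..<k} \<rightarrow>\<^sub>E \<Sigma>. vec (card C) (\<lambda>j. r (pick C j)) = x}
      = (\<Pi>\<^sub>E c\<in>{..<k}. if c \<in> C then {g c} else \<Sigma>)"
    (is "?L = ?M")
  proof (intro equalityI subsetI)
    fix r assume "r \<in> ?L"
    then show "r \<in> ?M" unfolding match by (simp add: PiE_iff)
  next
    fix r assume r: "r \<in> ?M"
    then have "r c = g c" if "c \<in> C" for c
      using PiE_mem[OF r, of c] that assms(2) by auto
    moreover have "r c \<in> \<Sigma>" if "c < k" for c
      using PiE_mem[OF r, of c] that g by (auto split: if_splits)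
    ultimately show "r \<in> ?L"
      using r unfolding match by (simp add: PiE_iff)
  qed
  also have "card \<dots> = (\<Prod>c<k. if c \<in> C then 1 else card \<Sigma>)"
    by (simp add: card_PiE if_distrib cong: if_cong)
  also have "\<dots> = card \<Sigma> ^ card ({..<k} - C)"
    by (simp add: prod.If_cases Diff_eq)
  finally show ?thesis using assms(2) finC by (simp add: card_Diff_subset)
qed

text \<open>The union bound runs over pairs \<open>(C, x)\<close>, with \<open>S (C, x)\<close> the
  rows that show \<open>x\<close> in the columns \<open>C\<close>. Each such set has
  \<open>s = v ^ (k - t)\<close> of the \<open>v ^ t * s\<close> rows, so \<open>s ^ N\<close>
  cancels from the counting condition.\<close>

lemma ex_covering_array:
  assumes "finite \<Sigma>" "card \<Sigma> = v" "t \<le> k" "2 \<le> v ^ t"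
    and less: "(k choose t) * v ^ t * ((v ^ t - 1) ^ N * (\<Sum>j<l. N choose j)) < (v ^ t) ^ N"
  shows "\<exists>A. covering_array l N t k v \<Sigma> A"
proof -
  define Cs where "Cs = {C. C \<subseteq> {..<k} \<and> card C = t}"
  define X where "X = {x \<in> carrier_vec t. set\<^sub>v x \<subseteq> \<Sigma>}"
  define R where "R = {..<k} \<rightarrow>\<^sub>E \<Sigma>"
  define S where "S = (\<lambda>(C, x). {r \<in> R. vec t (\<lambda>j. r (pick C j)) = x})"
  define s where "s = v ^ (k - t)"
  have finR: "finite R" unfolding R_def using assms by (intro finite_PiE) auto
  have cardR: "card R = v ^ t * s"
    using assms by (simp add: R_def s_def card_PiE flip: power_add)
  have s: "s > 0" using assms(4) by (cases "v = 0") (auto simp: s_def power_0_left split: if_splits)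
  have finP: "finite (Cs \<times> X)"
    unfolding Cs_def X_def using card_vecs_le(1) assms(1)
    by (intro finite_cartesian_product) auto
  have "card Cs = k choose t" unfolding Cs_def using n_subsets[of "{..<k}" t] by simp
  then have cardP: "card (Cs \<times> X) \<le> (k choose t) * v ^ t"
    using card_vecs_le(2)[OF assms(1), of t] assms(2)
    by (simp add: card_cartesian_product X_def)
  have cardS: "card (S q) = s" if "q \<in> Cs \<times> X" for q
    using that card_rows_matching[OF assms(1), of "fst q" k "snd q"] assms(2)
    by (auto simp: S_def s_def R_def Cs_def X_def)
  have subS: "S q \<subseteq> R" for q by (auto simp: S_def split: prod.split)
  have diff: "card R - s = (v ^ t - 1) * s" by (simp add: cardR diff_mult_distrib)
  have "card (Cs \<times> X) * ((card R - s) ^ N * (\<Sum>j<l. N choose j))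
      \<le> (k choose t) * v ^ t * ((card R - s) ^ N * (\<Sum>j<l. N choose j))"
    using cardP by (rule mult_right_mono) simp
  also have "\<dots> = (k choose t) * v ^ t * ((v ^ t - 1) ^ N * (\<Sum>j<l. N choose j)) * s ^ N"
    by (simp only: diff power_mult_distrib mult_ac)
  also have "\<dots> < (v ^ t) ^ N * s ^ N" using less s by simp
  also have "\<dots> = card R ^ N" by (simp add: cardR power_mult_distrib)
  finally have few: "card (Cs \<times> X) * ((card R - s) ^ N * (\<Sum>j<l. N choose j)) < card R ^ N" .
  \<comment> \<open>In terms of probabilities this is \<open>p \<le> 1 / 2\<close>.\<close>
  have half: "2 * s \<le> card R" unfolding cardR using assms(4) by (rule mult_right_mono) simp
  from ex_funcset_many_hits[OF finR finP subS cardS half few]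
  obtain f where f: "f \<in> {..<N} \<rightarrow>\<^sub>E R"
      "\<forall>q \<in> Cs \<times> X. l \<le> card {i. i < N \<and> f i \<in> S q}"
    by (rule bexE)
  define A where "A = mat N k (\<lambda>(i, c). f i c)"
  have fi: "f i \<in> R" if "i < N" for i using f(1) that by auto
  have "elements_mat A \<subseteq> \<Sigma>"
  proof
    fix a assume "a \<in> elements_mat A"
    then obtain i j where "i < N" "j < k" "a = f i j"
      by (auto simp: A_def dest!: elements_matD)
    then show "a \<in> \<Sigma>" using PiE_mem[OF fi[unfolded R_def]] by simp
  qed
  moreover have "l \<le> card {i. i < N \<and> row (submatrix A {..<N} C) i = x}"
    if "C \<subseteq> {..<k}" "card C = t" "x \<in> carrier_vec t" "set\<^sub>v x \<subseteq> \<Sigma>" for C x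
  proof -
    have "{i. i < N \<and> row (submatrix A {..<N} C) i = x} = {i. i < N \<and> f i \<in> S (C, x)}"
      using that fi by (auto simp: A_def S_def row_submatrix_mat)
    then show ?thesis using bspec[OF f(2), of "(C, x)"] that by (simp add: Cs_def X_def)
  qed
  ultimately have "covering_array l N t k v \<Sigma> A"
    using assms by (auto simp: covering_array_def A_def)
  then show ?thesis ..
qed

theorem theorem7p1:
  fixes N t k v :: nat and p b :: real and \<Sigma> :: "'a set"
  assumes "N \<ge> 1" and "t \<ge> 2" and "k \<ge> t" and "v \<ge> 2"
    and "finite \<Sigma>" and "card \<Sigma> = v"
    and "p = 1 / real v ^ t"
    and "b = real (k choose t) * real v ^ t * (1 - p) ^ (N + 1) * sqrt (1 / (1 - 2 * p))"
    and "1 / exp 1 ^ N < b" and "b < 1"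
  shows "\<exists>A. covering_array
           (nat (\<lceil>real N * exp (1 + Lambert_W_m1 (ln b / (exp 1 * real N)))\<rceil> - 1))
           N t k v \<Sigma> A"
proof -
  define x where "x = real N * exp (1 + Lambert_W_m1 (ln b / (exp 1 * real N)))"
  define l where "l = nat (\<lceil>x\<rceil> - 1)"
  define V where "V = v ^ t"
  have "2 ^ 2 \<le> v ^ 2" using assms(4) by (rule power_mono) simp
  also have "\<dots> \<le> v ^ t" using assms by (intro power_increasing) auto
  finally have V: "4 \<le> V" by (simp add: V_def)
  have p: "p = 1 / real V" using assms by (simp add: V_def)
  have p_bounds: "0 < p" "p \<le> 1 / 4" using V by (auto simp: p field_simps)
  \<comment> \<open>Because \<open>(1 - p)\<^sup>2 = 1 - 2 * p + p\<^sup>2\<close>. Hence the extra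
    factor \<open>1 - p\<close> and the square root in \<open>b\<close> have product at least 1, and
    \<open>b\<close> dominates the union bound factor \<open>m * (1 - p) ^ N\<close>.\<close>
  have "1 / (1 - 2 * p) \<ge> (1 / (1 - p))\<^sup>2"
    unfolding power_one_over using p_bounds
    by (intro divide_left_mono mult_pos_pos zero_less_power)
      (auto simp: power2_eq_square algebra_simps)
  then have "1 / (1 - p) \<le> sqrt (1 / (1 - 2 * p))" by (rule real_le_rsqrt)
  then have sq: "1 \<le> (1 - p) * sqrt (1 / (1 - 2 * p))"
    using p_bounds by (simp add: field_simps)
  define m where "m = real (k choose t) * real V"
  have m: "m > 0" using V assms by (auto simp: m_def)
  have "m * (1 - p) ^ N * 1 \<le> m * (1 - p) ^ N * ((1 - p) * sqrt (1 / (1 - 2 * p)))"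
    using sq m p_bounds by (intro mult_left_mono) auto
  also have "\<dots> = b" using assms(8) by (simp add: m_def V_def mult_ac)
  finally have mb: "m * (1 - p) ^ N \<le> b" by simp
  have "m * (1 - p) ^ N * (\<Sum>j<l. real (N choose j)) < 1"
  \<comment> \<open>For \<open>l = 0\<close> the sum is empty. Otherwise \<open>nat\<close>
    truncates nothing, and subtracting 1 from the ceiling makes \<open>l < x\<close> strict.\<close>
  proof (cases "l = 0")
    case False
    have "real l = of_int (\<lceil>x\<rceil> - 1)" using False unfolding l_def by simp
    then have "real l < x" by linarith
    note * = less_exp_Lambert_W_m1_imp[OF _ _ assms(9,10) this[unfolded x_def]]
    have "(\<Sum>j<l. real (N choose j)) \<le> (exp 1 * real N / real l) ^ l"
      using sum_choose_le *(1) False assms(1) by simp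
    moreover have "0 < m * (1 - p) ^ N" using m p_bounds by simp
    then have "0 \<le> b" using mb by linarith
    ultimately have "m * (1 - p) ^ N * (\<Sum>j<l. real (N choose j))
        \<le> b * (exp 1 * real N / real l) ^ l"
      using mb by (intro mult_mono sum_nonneg) simp_all
    also have "\<dots> < 1" using *(2) False assms(1) by simp
    finally show ?thesis .
  qed simp
  \<comment> \<open>Multiplying by \<open>V ^ N\<close> clears the denominators and leaves an
    inequality between natural numbers.\<close>
  moreover have "1 - p = (real V - 1) / real V" using V by (simp add: p field_simps)
  ultimately have "m * ((real V - 1) ^ N * (\<Sum>j<l. real (N choose j))) < real V ^ N"
    using V by (simp add: power_divide field_simps)
  moreover have "real (V - 1) = real V - 1" using V by simp
  ultimately have "real ((k choose t) * V * ((V - 1) ^ N * (\<Sum>j<l. N choose j))) < real (V ^ N)"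
    by (simp only: m_def of_nat_mult of_nat_power of_nat_sum)
  then have "(k choose t) * v ^ t * ((v ^ t - 1) ^ N * (\<Sum>j<l. N choose j)) < (v ^ t) ^ N"
    unfolding V_def[symmetric] by (simp only: of_nat_less_iff)
  from ex_covering_array[OF assms(5,6,3) _ this] V show ?thesis
    by (simp add: V_def l_def x_def)
qed

end
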